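(* The dual cone of the cone of even symmetric ternary octics that are sums of squares has the following description: $$\left(\Sigma_{3,8}^{B_3}\right)^\ast=\operatorname{cone}\left\{\operatorname{ev}_{\left(a,\sqrt{1-a^2},0\right)},\ \operatorname{ev}_{(b,c,c)}\;:\;\tfrac12\leq a\leq 1,\ 0\leq b\leq 1,\ c=\sqrt{\tfrac{1-b^2}{2}}\right\}.$$
   Context: $B_3$ is the group of all coordinate permutations and sign changes on $\mathbb{R}^3$. $H_{3,8}^{B_3}$ is the space of $B_3$-invariant real forms of degree 8 in three variables (even symmetric ternary octics), and $\Sigma_{3,8}^{B_3}\subset H_{3,8}^{B_3}$ is the cone of those that are sums of squares of real forms. For a cone $K$ in a real vector space $V$, $K^\ast=\{\ell\in\operatorname{Hom}(V,\mathbb{R}):\ell(K)\subseteq\mathbb{R}_{\geq0}\}$; here $V=H_{3,8}^{B_3}$. $\operatorname{ev}_z$ is the point evaluation $f\mapsto f(z)$, regarded as a linear functional on $H_{3,8}^{B_3}$, and $\operatorname{cone}$ denotes the convex cone generated by a set. *)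

theory Defs
  imports "HOL-Analysis.Analysis"
begin

text \<open>
  Real forms in \<open>CARD('n)\<close> variables are represented by the polynomial functions
  they induce on \<^typ>\<open>real ^ 'n\<close>; since the reals are an infinite field, this loses nothing.
\<close>

definition forms :: "nat \<Rightarrow> (real ^ 'n \<Rightarrow> real) set" where
  "forms d = {f. \<exists>c :: ('n \<Rightarrow> nat) \<Rightarrow> real.
     f = (\<lambda>x. \<Sum>\<alpha> | (\<Sum>i\<in>UNIV. \<alpha> i) = d. c \<alpha> * (\<Prod>i\<in>UNIV. (x $ i) ^ \<alpha> i))}"

text \<open>The sum over exponents in \<^const>\<open>forms\<close> is a genuine finite sum:\<close>

lemma finite_exponents: "finite {\<alpha> :: 'n::finite \<Rightarrow> nat. (\<Sum>i\<in>UNIV. \<alpha> i) = d}"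
proof (rule finite_subset)
  show "{\<alpha> :: 'n \<Rightarrow> nat. (\<Sum>i\<in>UNIV. \<alpha> i) = d} \<subseteq> PiE UNIV (\<lambda>_. {..d})"
    by (auto intro: member_le_sum)
  show "finite (PiE (UNIV :: 'n set) (\<lambda>_. {..d}))"
    by (intro finite_PiE) auto
qed

definition signed_perms :: "(real ^ 'n \<Rightarrow> real ^ 'n) set" where
  "signed_perms = {\<lambda>x. \<chi> i. s i * x $ p i | p s. p permutes UNIV \<and> (\<forall>i. s i \<in> {-1, 1})}"

definition invariant_forms :: "nat \<Rightarrow> (real ^ 'n \<Rightarrow> real) set" where
  "invariant_forms d = {f \<in> forms d. \<forall>\<sigma>\<in>signed_perms. \<forall>x. f (\<sigma> x) = f x}"

text \<open>
  If a sum of squares of forms is a form of degree \<open>2 * d\<close>, the nonzero summands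
  are squares of forms of degree \<open>d\<close>. The summands need not be invariant.
\<close>

definition invariant_sos :: "nat \<Rightarrow> (real ^ 'n \<Rightarrow> real) set" where
  "invariant_sos d = {f \<in> invariant_forms (2 * d). \<exists>(k::nat) g.
     (\<forall>i<k. g i \<in> forms d) \<and> f = (\<lambda>x. \<Sum>i<k. (g i x)\<^sup>2)}"

text \<open>
  For a linear subspace \<open>V\<close> of real-valued functions, elements of \<open>Hom(V, \<real>)\<close> are
  functions with domain \<open>V\<close>, i.e. members of \<^term>\<open>extensional V\<close>, so that equality of
  functionals is equality on \<open>V\<close>.
\<close>

definition functionals :: "('a \<Rightarrow> real) set \<Rightarrow> (('a \<Rightarrow> real) \<Rightarrow> real) set" where
  "functionals V = {l \<in> extensional V.
     (\<forall>f\<in>V. \<forall>g\<in>V. l (\<lambda>x. f x + g x) = l f + l g) \<and>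
     (\<forall>r. \<forall>f\<in>V. l (\<lambda>x. r * f x) = r * l f)}"

definition dual_cone :: "('a \<Rightarrow> real) set \<Rightarrow> ('a \<Rightarrow> real) set \<Rightarrow> (('a \<Rightarrow> real) \<Rightarrow> real) set" where
  "dual_cone V K = {l \<in> functionals V. \<forall>f\<in>K. l f \<ge> 0}"

definition point_eval :: "('a \<Rightarrow> real) set \<Rightarrow> 'a \<Rightarrow> ('a \<Rightarrow> real) \<Rightarrow> real" where
  "point_eval V z = (\<lambda>f\<in>V. f z)"

definition cone_gen ::
  "('a \<Rightarrow> real) set \<Rightarrow> (('a \<Rightarrow> real) \<Rightarrow> real) set \<Rightarrow> (('a \<Rightarrow> real) \<Rightarrow> real) set" where
  "cone_gen V S = {(\<lambda>f\<in>V. \<Sum>l\<in>F. w l * l f) | F w.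
     finite F \<and> F \<subseteq> S \<and> (\<forall>l\<in>F. w l \<ge> 0)}"

end

theory Submission
  imports Defs
begin

text \<open>
  In the squared coordinates, even symmetric ternary octics are the symmetric quartic forms, a
  space of dimension four. Let \<open>p\<^sub>k\<close> be the power sums of the squared coordinates,
  \<open>q = (3 p\<^sub>2 - p\<^sub>1\<^sup>2) / 2\<close> and \<open>c = (9 p\<^sub>3 - 9 p\<^sub>1 p\<^sub>2 + 2 p\<^sub>1\<^sup>3) / 2\<close>. On the basis
  \<open>p\<^sub>1\<^sup>4, p\<^sub>1\<^sup>2 q, p\<^sub>1 c, q\<^sup>2\<close> the evaluations at unit vectors with two equal coordinates trace the curve
  \<open>(1, s\<^sup>2, s\<^sup>3, s\<^sup>4)\<close> with \<open>-1/2 \<le> s \<le> 1\<close>, and those at unit vectors with a zero coordinate trace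
  \<open>(1, s, (3 s - 1) / 2, s\<^sup>2)\<close> with \<open>1/4 \<le> s \<le> 1\<close>. A handful of explicit sums of squares shows that a
  functional in the dual cone has values \<open>(m0, m2, m3, m4)\<close> with \<open>m2\<^sup>2 \<le> m0 m4\<close>,
  \<open>m3\<^sup>2 \<le> m2 m4\<close>, \<open>m0 - 3 m2 + 2 m3 \<ge> 0\<close> and \<open>m2 + m3 - 2 m4 \<ge> 0\<close>. Subtracting the evaluation
  at \<open>s = 0\<close>, which only lowers \<open>m0\<close>, until the first or the third inequality is tight leaves a
  planar problem: in the first case the value of \<open>q\<close> is concentrated at one point and the functional
  lies on a segment between two test evaluations; in the other it lies between an arc of a parabola and its chord.
\<close>

section \<open>Forms\<close>

lemma forms_monomial:
  assumes "(\<Sum>i\<in>UNIV. \<alpha> i) = d"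
  shows "(\<lambda>x :: real ^ 'n. \<Prod>i\<in>UNIV. (x $ i) ^ \<alpha> i) \<in> forms d"
  unfolding forms_def mem_Collect_eq
proof (intro exI[of _ "\<lambda>\<beta>. if \<beta> = \<alpha> then 1 else 0"] ext)
  fix x :: "real ^ 'n"
  show "(\<Prod>i\<in>UNIV. (x $ i) ^ \<alpha> i) =
    (\<Sum>\<beta> | (\<Sum>i\<in>UNIV. \<beta> i) = d. (if \<beta> = \<alpha> then 1 else 0) * (\<Prod>i\<in>UNIV. (x $ i) ^ \<beta> i))"
    using assms finite_exponents[where 'n = 'n]
    by (subst sum.mono_neutral_right[of _ "{\<alpha>}"]) auto
qed

lemma forms_add:
  assumes "f \<in> forms d" "g \<in> forms d"
  shows "(\<lambda>x. f x + g x) \<in> forms d"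
proof -
  obtain a b where
    "f = (\<lambda>x. \<Sum>\<alpha> | (\<Sum>i\<in>UNIV. \<alpha> i) = d. a \<alpha> * (\<Prod>i\<in>UNIV. (x $ i) ^ \<alpha> i))"
    "g = (\<lambda>x. \<Sum>\<alpha> | (\<Sum>i\<in>UNIV. \<alpha> i) = d. b \<alpha> * (\<Prod>i\<in>UNIV. (x $ i) ^ \<alpha> i))"
    using assms unfolding forms_def by blast
  then show ?thesis
    unfolding forms_def
    by (auto intro!: exI[of _ "\<lambda>\<alpha>. a \<alpha> + b \<alpha>"] simp: ring_distribs sum.distrib)
qed

lemma forms_scale:
  assumes "f \<in> forms d"
  shows "(\<lambda>x. r * f x) \<in> forms d"
proof -
  obtain a where
    "f = (\<lambda>x. \<Sum>\<alpha> | (\<Sum>i\<in>UNIV. \<alpha> i) = d. a \<alpha> * (\<Prod>i\<in>UNIV. (x $ i) ^ \<alpha> i))"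
    using assms unfolding forms_def by blast
  then show ?thesis
    unfolding forms_def
    by (auto intro!: exI[of _ "\<lambda>\<alpha>. r * a \<alpha>"] simp: sum_distrib_left mult.assoc)
qed

lemma forms_diff:
  assumes "f \<in> forms d" "g \<in> forms d"
  shows "(\<lambda>x. f x - g x) \<in> forms d"
  using forms_add[OF assms(1) forms_scale[OF assms(2), of "- 1"]] by simp

lemma forms_zero: "(\<lambda>x. 0) \<in> forms d"
  unfolding forms_def by (auto intro!: exI[of _ "\<lambda>_. 0"])

lemma forms_sum:
  assumes "\<And>a. a \<in> A \<Longrightarrow> f a \<in> forms d"
  shows "(\<lambda>x. \<Sum>a\<in>A. f a x) \<in> forms d"
  using assms by (induction A rule: infinite_finite_induct) (auto intro: forms_add forms_zero)

lemma forms_mult: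
  fixes f g :: "real ^ 'n \<Rightarrow> real"
  assumes "f \<in> forms d" "g \<in> forms e"
  shows "(\<lambda>x. f x * g x) \<in> forms (d + e)"
proof -
  obtain a b where fg:
    "f = (\<lambda>x. \<Sum>\<alpha> | (\<Sum>i\<in>UNIV. \<alpha> i) = d. a \<alpha> * (\<Prod>i\<in>UNIV. (x $ i) ^ \<alpha> i))"
    "g = (\<lambda>x. \<Sum>\<alpha> | (\<Sum>i\<in>UNIV. \<alpha> i) = e. b \<alpha> * (\<Prod>i\<in>UNIV. (x $ i) ^ \<alpha> i))"
    using assms unfolding forms_def by blast
  have "(\<lambda>x. f x * g x) = (\<lambda>x. \<Sum>\<alpha> | (\<Sum>i\<in>UNIV. \<alpha> i) = d. \<Sum>\<beta> | (\<Sum>i\<in>UNIV. \<beta> i) = e.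
      (a \<alpha> * b \<beta>) * (\<Prod>i\<in>UNIV. (x $ i) ^ (\<alpha> i + \<beta> i)))"
    unfolding fg by (simp add: sum_product power_add prod.distrib mult.assoc mult.left_commute)
  also have "\<dots> \<in> forms (d + e)"
    by (intro forms_sum forms_scale forms_monomial) (auto simp: sum.distrib)
  finally show ?thesis .
qed

lemma forms_power:
  assumes "f \<in> forms d"
  shows "(\<lambda>x. f x ^ k) \<in> forms (k * d)"
proof (induction k)
  case 0
  show ?case using forms_monomial[of "\<lambda>_. 0"] by simp
next
  case (Suc k)
  show ?case using forms_mult[OF assms Suc.IH] by simp
qed

lemma forms_coord: "(\<lambda>x :: real ^ 'n. x $ i) \<in> forms 1"
proof -
  have "(\<Prod>j\<in>UNIV. (x $ j) ^ (if j = i then 1 else 0)) = x $ i" for x :: "real ^ 'n"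
    by (subst prod.mono_neutral_right[of _ "{i}"]) auto
  then show ?thesis
    using forms_monomial[of "\<lambda>j. if j = i then 1 else 0" 1] by simp
qed

section \<open>Even symmetric ternary octics\<close>

definition even_power_sum :: "nat \<Rightarrow> real ^ 'n \<Rightarrow> real" where
  "even_power_sum k x = (\<Sum>i\<in>UNIV. (x $ i) ^ (2 * k))"

lemma even_power_sum_in_forms: "d = 2 * k \<Longrightarrow> even_power_sum k \<in> forms d"
  unfolding even_power_sum_def[abs_def]
  using forms_power[OF forms_coord] by (auto intro!: forms_sum)

lemma even_power_sum_signed_perm:
  assumes "\<sigma> \<in> signed_perms"
  shows "even_power_sum k (\<sigma> x) = even_power_sum k x"
proof -
  obtain p s where \<sigma>: "\<sigma> = (\<lambda>x. \<chi> i. s i * x $ p i)" and p: "p permutes UNIV"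
    and s: "\<forall>i. s i \<in> {-1, 1}"
    using assms unfolding signed_perms_def by blast
  have "(s i * x $ p i) ^ (2 * k) = (x $ p i) ^ (2 * k)" for i
    using s[rule_format, of i] by auto
  then have "even_power_sum k (\<sigma> x) = (\<Sum>i\<in>UNIV. (x $ p i) ^ (2 * k))"
    unfolding even_power_sum_def \<sigma> by simp
  also have "\<dots> = even_power_sum k x"
    unfolding even_power_sum_def using sum.permute[OF p, of "\<lambda>i. (x $ i) ^ (2 * k)"]
    by (simp add: comp_def)
  finally show ?thesis .
qed

text \<open>In three variables, with squared coordinates x, y, z, this is x^2 + y^2 + z^2 - x y - y
  z - z x, half the sum of the squared differences.\<close>

definition quad_sym :: "real ^ 'n \<Rightarrow> real" where
  "quad_sym x = (3 * even_power_sum 2 x - (even_power_sum 1 x)\<^sup>2) / 2"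

lemma quad_sym_in_forms: "quad_sym \<in> forms 4"
proof -
  have "(\<lambda>x. 3 * even_power_sum 2 x - (even_power_sum 1 x)\<^sup>2) \<in> forms 4"
    using forms_power[OF even_power_sum_in_forms[of 2 1], of 2] even_power_sum_in_forms[of 4 2]
    by (intro forms_diff forms_scale) simp_all
  from forms_scale[OF this, of "1 / 2"] show ?thesis
    by (simp add: quad_sym_def[abs_def])
qed

text \<open>In three variables, with squared coordinates x, y, z, this is the product (2 x - y - z)
  (2 y - x - z) (2 z - x - y) / 2.\<close>

definition cubic_sym :: "real ^ 'n \<Rightarrow> real" where
  "cubic_sym x = (9 * even_power_sum 3 x - 9 * even_power_sum 1 x * even_power_sum 2 x
     + 2 * even_power_sum 1 x ^ 3) / 2"

text \<open>
  The normalisation makes the four basis octics take the values \<open>1, s\<^sup>2, s\<^sup>3, s\<^sup>4\<close> at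
  a unit vector with squared coordinates \<open>((1 + 2 * s) / 3, (1 - s) / 3, (1 - s) / 3)\<close>.
\<close>

definition octic :: "real \<Rightarrow> real \<Rightarrow> real \<Rightarrow> real \<Rightarrow> real ^ 'n \<Rightarrow> real" where
  "octic a b c d x = a * even_power_sum 1 x ^ 4 + b * ((even_power_sum 1 x)\<^sup>2 * quad_sym x)
     + c * (even_power_sum 1 x * cubic_sym x) + d * (quad_sym x)\<^sup>2"

lemma octic_in_invariant_forms: "octic a b c d \<in> invariant_forms 8"
proof -
  have p: "even_power_sum 1 \<in> forms 2" "even_power_sum 2 \<in> forms 4"
     "even_power_sum 3 \<in> forms 6"
    by (auto intro: even_power_sum_in_forms)
  note q = quad_sym_in_forms
  have c3: "cubic_sym \<in> forms 6"
    unfolding cubic_sym_def[abs_def]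
    using forms_scale[OF forms_add[OF forms_diff[OF forms_scale[OF p(3), of 9]
       forms_scale[OF forms_mult[OF p(1,2)], of 9, simplified]]
       forms_scale[OF forms_power[OF p(1), of 3], of 2, simplified]], of "1/2"]
    by (simp add: mult.assoc)
  have "octic a b c d \<in> forms 8"
    unfolding octic_def[abs_def]
    using forms_power[OF p(1), of 4] forms_mult[OF forms_power[OF p(1), of 2] q]
      forms_mult[OF p(1) c3] forms_power[OF q, of 2]
    by (intro forms_add forms_scale) simp_all
  then show ?thesis
    unfolding invariant_forms_def octic_def quad_sym_def cubic_sym_def
    by (auto simp: even_power_sum_signed_perm)
qed

lemma even_power_sum_vector_3:
  "even_power_sum k (vector [a, b, c] :: real ^ 3) = (a\<^sup>2) ^ k + (b\<^sup>2) ^ k + (c\<^sup>2) ^ k"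
  by (simp add: even_power_sum_def sum_3 power_mult)

lemma octic_vector_3:
  fixes a b c :: real
  defines "x \<equiv> a\<^sup>2" and "y \<equiv> b\<^sup>2" and "z \<equiv> c\<^sup>2"
  shows "octic p q r s (vector [a, b, c] :: real ^ 3) =
    p * (x + y + z)^4 + q * ((x + y + z)\<^sup>2 * (x\<^sup>2 + y\<^sup>2 + z\<^sup>2 - x * y - y * z - z * x))
    + r * ((x + y + z) * ((2 * x - y - z) * (2 * y - x - z) * (2 * z - x - y) / 2))
    + s * (x\<^sup>2 + y\<^sup>2 + z\<^sup>2 - x * y - y * z - z * x)\<^sup>2"
proof -
  have q: "quad_sym (vector [a, b, c] :: real ^ 3) = x\<^sup>2 + y\<^sup>2 + z\<^sup>2 - x * y - y * z - z * x"
    unfolding quad_sym_def even_power_sum_vector_3 x_def[symmetric] y_def[symmetric] z_def[symmetric]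
    by (simp add: field_simps power2_eq_square)
  have c: "cubic_sym (vector [a, b, c] :: real ^ 3) = (2 * x - y - z) * (2 * y - x - z) * (2 * z - x - y) / 2"
    unfolding cubic_sym_def even_power_sum_vector_3 x_def[symmetric] y_def[symmetric] z_def[symmetric]
    by (simp add: field_simps power2_eq_square power3_eq_cube)
  show ?thesis
    unfolding octic_def q c even_power_sum_vector_3 by (simp add: x_def y_def z_def)
qed

section \<open>The four basis octics span the invariant octics\<close>

text \<open>Up to order there are only four exponent triples of sum 4, and each is solved
  explicitly. The factor 27 clears the denominators; the cubic product appears without its factor
  1/2.\<close>

lemma monomial_orbit_sum_even:
  fixes i j k :: nat
  assumes "i + j + k = 4"
  shows "\<exists>p q r s. \<forall>x y z :: real.
    27 * (x^i * y^j * z^k + y^i * x^j * z^k + x^i * z^j * y^k +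
    z^i * y^j * x^k + y^i * z^j * x^k + z^i * x^j * y^k) =
    p * (x + y + z)^4 + q * ((x + y + z)\<^sup>2 * (x\<^sup>2 + y\<^sup>2 + z\<^sup>2 - x * y - y * z - z * x))
    + r * ((x + y + z) * ((2 * x - y - z) * (2 * y - x - z) * (2 * z - x - y)))
    + s * (x\<^sup>2 + y\<^sup>2 + z\<^sup>2 - x * y - y * z - z * x)\<^sup>2"
proof -
  define M where "M i j k x y z = x^i * y^j * z^k + y^i * x^j * z^k + x^i * z^j * y^k +
    z^i * y^j * x^k + y^i * z^j * x^k + z^i * x^j * y^k" for i j k and x y z :: real
  define P where "P m \<longleftrightarrow> (\<exists>p q r s. \<forall>x y z. 27 * m x y z =
    p * (x + y + z)^4 + q * ((x + y + z)\<^sup>2 * (x\<^sup>2 + y\<^sup>2 + z\<^sup>2 - x * y - y * z - z * x))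
    + r * ((x + y + z) * ((2 * x - y - z) * (2 * y - x - z) * (2 * z - x - y)))
    + s * (x\<^sup>2 + y\<^sup>2 + z\<^sup>2 - x * y - y * z - z * x)\<^sup>2)" for m :: "real \<Rightarrow> real \<Rightarrow> real \<Rightarrow> real"
  \<comment> \<open>These eleven equations reduce all fifteen exponent triples to the four sorted
    ones.\<close>
  have M: "M 0 4 0 = M 4 0 0" "M 0 0 4 = M 4 0 0" "M 3 0 1 = M 3 1 0" "M 1 3 0 = M 3 1 0"
    "M 1 0 3 = M 3 1 0" "M 0 3 1 = M 3 1 0" "M 0 1 3 = M 3 1 0" "M 2 0 2 = M 2 2 0"
    "M 0 2 2 = M 2 2 0" "M 1 2 1 = M 2 1 1" "M 1 1 2 = M 2 1 1"
    unfolding M_def by (simp_all add: fun_eq_iff)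
  \<comment> \<open>The witnesses solve linear systems obtained by comparing coefficients. Putting x
    = y = z = 1 forces the first to be 2 in all four cases, since 27 * 6 = 2 * 81.\<close>
  have "P (M 4 0 0)"
    unfolding P_def M_def power_0 mult_1_right mult_1_left
    by (rule exI[of _ 2], rule exI[of _ 24], rule exI[of _ 8], rule exI[of _ 12], intro allI) algebra
  moreover have "P (M 3 1 0)"
    unfolding P_def M_def power_0 power_one_right mult_1_right mult_1_left
    by (rule exI[of _ 2], rule exI[of _ 6], rule exI[of _ "-1"], rule exI[of _ "-6"], intro allI) algebra
  moreover have "P (M 2 2 0)"
    unfolding P_def M_def power_0 mult_1_right mult_1_left
    by (rule exI[of _ 2], rule exI[of _ 0], rule exI[of _ "-4"], rule exI[of _ 6], intro allI) algebra
  moreover have "P (M 2 1 1)"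
    unfolding P_def M_def power_one_right
    by (rule exI[of _ 2], rule exI[of _ "-6"], rule exI[of _ 2], rule exI[of _ 0], intro allI) algebra
  moreover have "i = 0 \<or> i = 1 \<or> i = 2 \<or> i = 3 \<or> i = 4" "j = 0 \<or> j = 1 \<or> j = 2 \<or> j = 3 \<or> j = 4"
    "k = 4 - i - j"
    using assms by linarith+
  ultimately have "P (M i j k)"
    using assms M by (elim disjE) simp_all
  then show ?thesis unfolding P_def M_def .
qed

text \<open>The sign factor is what summation over the eight sign changes leaves of a monomial: 0 if
  some exponent is odd, 8 otherwise. In the latter case the exponents are halved and the quartic
  case applies.\<close>

lemma monomial_orbit_sum:
  fixes i j k :: nat
  assumes "i + j + k = 8"
  shows "\<exists>p q r s. \<forall>a b c :: real.
    (1 + (-1)^i) * (1 + (-1)^j) * (1 + (-1)^k) *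
    (a^i * b^j * c^k + b^i * a^j * c^k + a^i * c^j * b^k +
    c^i * b^j * a^k + b^i * c^j * a^k + c^i * a^j * b^k) =
    octic p q r s (vector [a, b, c] :: real ^ 3)"
proof (cases "even i \<and> even j \<and> even k")
  case True
  then obtain i' j' k' where ijk: "i = 2 * i'" "j = 2 * j'" "k = 2 * k'"
    by (auto elim!: evenE)
  with assms have "i' + j' + k' = 4" by simp
  from monomial_orbit_sum_even[OF this] obtain p q r s where *: "\<And>x y z :: real.
    27 * (x^i' * y^j' * z^k' + y^i' * x^j' * z^k' + x^i' * z^j' * y^k' +
    z^i' * y^j' * x^k' + y^i' * z^j' * x^k' + z^i' * x^j' * y^k') =
    p * (x + y + z)^4 + q * ((x + y + z)\<^sup>2 * (x\<^sup>2 + y\<^sup>2 + z\<^sup>2 - x * y - y * z - z * x))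
    + r * ((x + y + z) * ((2 * x - y - z) * (2 * y - x - z) * (2 * z - x - y)))
    + s * (x\<^sup>2 + y\<^sup>2 + z\<^sup>2 - x * y - y * z - z * x)\<^sup>2"
    by blast
  have c: "(1 + (-1)^i) * (1 + (-1)^j) * (1 + (-1)^k) = (8 :: real)"
    by (simp add: ijk)
  \<comment> \<open>The cubic product is halved in \<open>octic_vector_3\<close>, so its coefficient
    is 16 / 27 instead of 8 / 27.\<close>
  have scale: "8 * m = 8 / 27 * p * E + 8 / 27 * q * G + 16 / 27 * r * (H * (K / 2)) + 8 / 27 * s * T"
    if "27 * m = p * E + q * G + r * (H * K) + s * T" for m E G H K T :: real
    using that by (simp add: field_simps)
  show ?thesis
    unfolding c unfolding octic_vector_3 ijk power_mult
    by (rule exI[of _ "8 / 27 * p"], rule exI[of _ "8 / 27 * q"], rule exI[of _ "16 / 27 * r"],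
        rule exI[of _ "8 / 27 * s"], intro allI scale *)
next
  case False
  then have "(1 + (-1)^i) * (1 + (-1)^j) * (1 + (-1)^k) = (0 :: real)" by auto
  then show ?thesis
    unfolding octic_vector_3 by (intro exI[of _ 0]) simp
qed

lemma octic_sum:
  "(\<Sum>\<alpha>\<in>A. r \<alpha> * octic (a \<alpha>) (b \<alpha>) (c \<alpha>) (d \<alpha>) x) =
    octic (\<Sum>\<alpha>\<in>A. r \<alpha> * a \<alpha>) (\<Sum>\<alpha>\<in>A. r \<alpha> * b \<alpha>) (\<Sum>\<alpha>\<in>A. r \<alpha> * c \<alpha>) (\<Sum>\<alpha>\<in>A. r \<alpha> * d \<alpha>) x"
  unfolding octic_def by (simp add: sum.distrib distrib_left sum_distrib_right mult.assoc)

lemma octic_divide: "octic a b c d x / r = octic (a / r) (b / r) (c / r) (d / r) x"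
  unfolding octic_def by (simp add: add_divide_distrib)

lemma invariant_forms_flip:
  assumes "f \<in> invariant_forms d"
  shows "f (\<chi> i. (if i = j then - (x $ i) else x $ i)) = f x"
proof -
  have "(\<lambda>x. \<chi> i. (if i = j then -1 else 1) * x $ id i) \<in> signed_perms"
    unfolding signed_perms_def using permutes_id
    by (intro CollectI exI[of _ id] exI[of _ "\<lambda>i. if i = j then -1 else 1"]) auto
  then have "f (\<chi> i. (if i = j then -1 else 1) * x $ id i) = f x"
    using assms bspec[of signed_perms "\<lambda>\<sigma>. \<forall>x. f (\<sigma> x) = f x"]
    unfolding invariant_forms_def by fast
  moreover have "(\<chi> i. (if i = j then -1 else 1) * x $ id i) = (\<chi> i. (if i = j then - (x $ i) else x $ i))"
    by (simp add: vec_eq_iff)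
  ultimately show ?thesis by simp
qed

lemma invariant_forms_swap:
  assumes "f \<in> invariant_forms d"
  shows "f (\<chi> i. x $ Transposition.transpose j k i) = f x"
proof -
  have "Transposition.transpose j k permutes UNIV"
    by (simp add: permutes_swap_id)
  then have "(\<lambda>x. \<chi> i. 1 * x $ Transposition.transpose j k i) \<in> signed_perms"
    unfolding signed_perms_def
    by (intro CollectI exI[of _ "Transposition.transpose j k"] exI[of _ "\<lambda>_. 1"]) auto
  then show ?thesis
    using assms unfolding invariant_forms_def by fastforce
qed

lemma vector_3_eta: "x = vector [x $ 1, x $ 2, x $ 3]" for x :: "'a::zero ^ 3"
  by (simp add: vec_eq_iff forall_3)

lemma prod_UNIV_3: "(\<Prod>i\<in>UNIV. g i) = g 1 * g 2 * g 3" for g :: "3 \<Rightarrow> 'a::comm_monoid_mult"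
  unfolding UNIV_3 by (simp add: ac_simps)

text \<open>An invariant form is the average of its 48 translates, and that average is a combination
  of symmetrised monomials, each of them an \<open>octic\<close>. The coefficients of
  \<open>f\<close> never have to be compared with each other.\<close>

lemma invariant_forms_8_octic:
  fixes f :: "real ^ 3 \<Rightarrow> real"
  assumes f: "f \<in> invariant_forms 8"
  shows "\<exists>p q r s. f = octic p q r s"
proof -
  define A where "A = {\<alpha> :: 3 \<Rightarrow> nat. (\<Sum>i\<in>UNIV. \<alpha> i) = 8}"
  obtain co where co: "f = (\<lambda>x. \<Sum>\<alpha>\<in>A. co \<alpha> * (\<Prod>i\<in>UNIV. (x $ i) ^ \<alpha> i))"
    using f unfolding invariant_forms_def forms_def A_def by blast
  define F where "F a b c = f (vector [a, b, c])" for a b c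
  have F: "F a b c = (\<Sum>\<alpha>\<in>A. co \<alpha> * (a ^ \<alpha> 1 * b ^ \<alpha> 2 * c ^ \<alpha> 3))" for a b c
    unfolding F_def co by (simp add: prod_UNIV_3)
  have flip: "F (- a) b c = F a b c" "F a (- b) c = F a b c" "F a b (- c) = F a b c" for a b c
  proof -
    have "(\<chi> i. if i = 1 then - (vector [a, b, c] $ i) else vector [a, b, c] $ i) = (vector [- a, b, c] :: real ^ 3)"
      "(\<chi> i. if i = 2 then - (vector [a, b, c] $ i) else vector [a, b, c] $ i) = (vector [a, - b, c] :: real ^ 3)"
      "(\<chi> i. if i = 3 then - (vector [a, b, c] $ i) else vector [a, b, c] $ i) = (vector [a, b, - c] :: real ^ 3)"
      by (simp_all add: vec_eq_iff forall_3)
    then show "F (- a) b c = F a b c" "F a (- b) c = F a b c" "F a b (- c) = F a b c"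
      unfolding F_def using invariant_forms_flip[OF f] by metis+
  qed
  have swap: "F b a c = F a b c" "F a c b = F a b c" for a b c
  proof -
    have "(\<chi> i. vector [a, b, c] $ Transposition.transpose 1 2 i) = (vector [b, a, c] :: real ^ 3)"
      "(\<chi> i. vector [a, b, c] $ Transposition.transpose 2 3 i) = (vector [a, c, b] :: real ^ 3)"
      by (simp_all add: vec_eq_iff forall_3 Transposition.transpose_def)
    then show "F b a c = F a b c" "F a c b = F a b c"
      unfolding F_def using invariant_forms_swap[OF f] by metis+
  qed
  define S where "S \<alpha> = ((1 + (-1)^\<alpha> 1) * (1 + (-1)^\<alpha> 2) * (1 + (-1)^\<alpha> 3) :: real)" for \<alpha> :: "3 \<Rightarrow> nat"
  \<comment> \<open>Summation over the eight sign changes; \<open>S\<close> collects the resulting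
    sign factors.\<close>
  have F8: "8 * F a b c = (\<Sum>\<alpha>\<in>A. co \<alpha> * (S \<alpha> * (a ^ \<alpha> 1 * b ^ \<alpha> 2 * c ^ \<alpha> 3)))" for a b c
  proof -
    have * : "k * (A * B * C) + k * (u * A * B * C) + k * (A * (v * B) * C) + k * (u * A * (v * B) * C)
        + k * (A * B * (w * C)) + k * (u * A * B * (w * C)) + k * (A * (v * B) * (w * C))
        + k * (u * A * (v * B) * (w * C)) = k * ((1 + u) * (1 + v) * (1 + w) * (A * B * C))"
      for k A B C u v w :: real
      by algebra
    have "8 * F a b c = F a b c + F (- a) b c + F a (- b) c + F (- a) (- b) c
        + F a b (- c) + F (- a) b (- c) + F a (- b) (- c) + F (- a) (- b) (- c)"
      unfolding flip by simp
    also have "\<dots> = (\<Sum>\<alpha>\<in>A. co \<alpha> * (S \<alpha> * (a ^ \<alpha> 1 * b ^ \<alpha> 2 * c ^ \<alpha> 3)))"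
      unfolding F sum.distrib[symmetric] S_def
      by (intro sum.cong refl) (simp only: power_minus[of a] power_minus[of b] power_minus[of c] *)
    finally show ?thesis .
  qed
  \<comment> \<open>Summation over the six permutations of the arguments, on top of the sign
    changes.\<close>
  have F48: "48 * F a b c = (\<Sum>\<alpha>\<in>A. co \<alpha> * (S \<alpha> *
      (a^\<alpha> 1 * b^\<alpha> 2 * c^\<alpha> 3 + b^\<alpha> 1 * a^\<alpha> 2 * c^\<alpha> 3 + a^\<alpha> 1 * c^\<alpha> 2 * b^\<alpha> 3 +
       c^\<alpha> 1 * b^\<alpha> 2 * a^\<alpha> 3 + b^\<alpha> 1 * c^\<alpha> 2 * a^\<alpha> 3 + c^\<alpha> 1 * a^\<alpha> 2 * b^\<alpha> 3)))" for a b c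
  proof -
    have "F c b a = F a b c" "F b c a = F a b c" "F c a b = F a b c"
      using swap by metis+
    then have "48 * F a b c = 8 * F a b c + 8 * F b a c + 8 * F a c b + 8 * F c b a
        + 8 * F b c a + 8 * F c a b"
      using swap by simp
    then show ?thesis
      unfolding F8 by (simp only: sum.distrib distrib_left)
  qed
  have "\<forall>\<alpha>\<in>A. \<exists>p q r s. \<forall>a b c. S \<alpha> *
      (a^\<alpha> 1 * b^\<alpha> 2 * c^\<alpha> 3 + b^\<alpha> 1 * a^\<alpha> 2 * c^\<alpha> 3 + a^\<alpha> 1 * c^\<alpha> 2 * b^\<alpha> 3 +
       c^\<alpha> 1 * b^\<alpha> 2 * a^\<alpha> 3 + b^\<alpha> 1 * c^\<alpha> 2 * a^\<alpha> 3 + c^\<alpha> 1 * a^\<alpha> 2 * b^\<alpha> 3) =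
      octic p q r s (vector [a, b, c] :: real ^ 3)"
    unfolding S_def by (intro ballI monomial_orbit_sum) (simp add: A_def sum_3)
  then obtain p q r s where "\<And>\<alpha> a b c. \<alpha> \<in> A \<Longrightarrow> S \<alpha> *
      (a^\<alpha> 1 * b^\<alpha> 2 * c^\<alpha> 3 + b^\<alpha> 1 * a^\<alpha> 2 * c^\<alpha> 3 + a^\<alpha> 1 * c^\<alpha> 2 * b^\<alpha> 3 +
       c^\<alpha> 1 * b^\<alpha> 2 * a^\<alpha> 3 + b^\<alpha> 1 * c^\<alpha> 2 * a^\<alpha> 3 + c^\<alpha> 1 * a^\<alpha> 2 * b^\<alpha> 3) =
      octic (p \<alpha>) (q \<alpha>) (r \<alpha>) (s \<alpha>) (vector [a, b, c] :: real ^ 3)"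
    unfolding bchoice_iff by blast
  then have *: "48 * F a b c = octic (\<Sum>\<alpha>\<in>A. co \<alpha> * p \<alpha>) (\<Sum>\<alpha>\<in>A. co \<alpha> * q \<alpha>)
      (\<Sum>\<alpha>\<in>A. co \<alpha> * r \<alpha>) (\<Sum>\<alpha>\<in>A. co \<alpha> * s \<alpha>) (vector [a, b, c] :: real ^ 3)" for a b c
    unfolding F48 octic_sum[symmetric] by simp
  have F_octic: "F a b c = octic (\<Sum>\<alpha>\<in>A. co \<alpha> * p \<alpha>) (\<Sum>\<alpha>\<in>A. co \<alpha> * q \<alpha>)
      (\<Sum>\<alpha>\<in>A. co \<alpha> * r \<alpha>) (\<Sum>\<alpha>\<in>A. co \<alpha> * s \<alpha>) (vector [a, b, c] :: real ^ 3) / 48" for a b c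
    using *[of a b c] by simp
  have "f = octic ((\<Sum>\<alpha>\<in>A. co \<alpha> * p \<alpha>) / 48) ((\<Sum>\<alpha>\<in>A. co \<alpha> * q \<alpha>) / 48)
      ((\<Sum>\<alpha>\<in>A. co \<alpha> * r \<alpha>) / 48) ((\<Sum>\<alpha>\<in>A. co \<alpha> * s \<alpha>) / 48)"
  proof
    fix x
    show "f x = octic ((\<Sum>\<alpha>\<in>A. co \<alpha> * p \<alpha>) / 48) ((\<Sum>\<alpha>\<in>A. co \<alpha> * q \<alpha>) / 48)
      ((\<Sum>\<alpha>\<in>A. co \<alpha> * r \<alpha>) / 48) ((\<Sum>\<alpha>\<in>A. co \<alpha> * s \<alpha>) / 48) x"
      using F_octic[of "x $ 1" "x $ 2" "x $ 3"]
      unfolding F_def octic_divide vector_3_eta[symmetric] .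
  qed
  then show ?thesis by blast
qed

section \<open>Functionals and their moments\<close>

lemma invariant_forms_add:
  assumes "f \<in> invariant_forms d" "g \<in> invariant_forms d"
  shows "(\<lambda>x. f x + g x) \<in> invariant_forms d"
  using assms forms_add unfolding invariant_forms_def by auto

lemma invariant_forms_scale:
  assumes "f \<in> invariant_forms d"
  shows "(\<lambda>x. r * f x) \<in> invariant_forms d"
  using assms forms_scale unfolding invariant_forms_def by auto

lemma cone_gen_add:
  assumes "l \<in> cone_gen V S" "m \<in> cone_gen V S"
  shows "(\<lambda>f\<in>V. l f + m f) \<in> cone_gen V S"
proof -
  obtain F v where l: "l = (\<lambda>f\<in>V. \<Sum>h\<in>F. v h * h f)" and F: "finite F" "F \<subseteq> S" "\<forall>h\<in>F. v h \<ge> 0"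
    using assms(1) unfolding cone_gen_def by blast
  obtain G w where m: "m = (\<lambda>f\<in>V. \<Sum>h\<in>G. w h * h f)" and G: "finite G" "G \<subseteq> S" "\<forall>h\<in>G. w h \<ge> 0"
    using assms(2) unfolding cone_gen_def by blast
  \<comment> \<open>The two supports may overlap, so both weights are extended by zero and
    added.\<close>
  define u where "u h = (if h \<in> F then v h else 0) + (if h \<in> G then w h else 0)" for h
  have "(\<Sum>h\<in>F. v h * h f) = (\<Sum>h\<in>F \<union> G. (if h \<in> F then v h else 0) * h f)" for f
    using F(1) G(1) by (intro sum.mono_neutral_cong_left) auto
  moreover have "(\<Sum>h\<in>G. w h * h f) = (\<Sum>h\<in>F \<union> G. (if h \<in> G then w h else 0) * h f)" for f
    using F(1) G(1) by (intro sum.mono_neutral_cong_left) auto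
  ultimately have "(\<lambda>f\<in>V. l f + m f) = (\<lambda>f\<in>V. \<Sum>h\<in>F \<union> G. u h * h f)"
    unfolding l m u_def by (auto simp: restrict_def fun_eq_iff distrib_right sum.distrib)
  then show ?thesis
    unfolding cone_gen_def using F G
    by (intro CollectI exI[of _ "F \<union> G"] exI[of _ u]) (auto simp: u_def)
qed

lemma cone_gen_generator:
  assumes "h \<in> S" "w \<ge> 0"
  shows "(\<lambda>f\<in>V. w * h f) \<in> cone_gen V S"
  unfolding cone_gen_def using assms
  by (intro CollectI exI[of _ "{h}"] exI[of _ "\<lambda>_. w"]) auto

text \<open>The indices are the powers of s that the basis octics take at unit vectors with two
  equal coordinates, which is why there is no first moment. Quantifying over all coefficients
  encodes linearity, and extensionality lets the moments determine \<open>l\<close>.\<close>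

definition has_moments :: "((real ^ 3 \<Rightarrow> real) \<Rightarrow> real) \<Rightarrow> real \<Rightarrow> real \<Rightarrow> real \<Rightarrow> real \<Rightarrow> bool" where
  "has_moments l m0 m2 m3 m4 \<longleftrightarrow> l \<in> extensional (invariant_forms 8) \<and>
     (\<forall>a b c d. l (octic a b c d) = a * m0 + b * m2 + c * m3 + d * m4)"

lemma has_moments_unique:
  assumes "has_moments l m0 m2 m3 m4" "has_moments l' m0 m2 m3 m4"
  shows "l = l'"
proof (rule extensionalityI)
  show "l \<in> extensional (invariant_forms 8)" "l' \<in> extensional (invariant_forms 8)"
    using assms by (auto simp: has_moments_def)
  fix f :: "real ^ 3 \<Rightarrow> real"
  assume "f \<in> invariant_forms 8"
  then show "l f = l' f"
    using assms invariant_forms_8_octic unfolding has_moments_def by metis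
qed

lemma functional_has_moments:
  assumes "l \<in> functionals (invariant_forms 8 :: (real ^ 3 \<Rightarrow> real) set)"
  shows "has_moments l (l (octic 1 0 0 0)) (l (octic 0 1 0 0)) (l (octic 0 0 1 0)) (l (octic 0 0 0 1))"
  unfolding has_moments_def
proof (intro conjI allI)
  let ?V = "invariant_forms 8 :: (real ^ 3 \<Rightarrow> real) set"
  show "l \<in> extensional ?V"
    using assms by (simp add: functionals_def)
  have add: "l (\<lambda>x. f x + g x) = l f + l g" if "f \<in> ?V" "g \<in> ?V" for f g
    using assms that unfolding functionals_def by blast
  have scale: "l (\<lambda>x. r * f x) = r * l f" if "f \<in> ?V" for f r
    using assms that unfolding functionals_def by blast
  fix a b c d :: real
  have o: "octic p q r s \<in> ?V" for p q r s
    by (rule octic_in_invariant_forms)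
  have plus: "l (octic (a + a') (b + b') (c + c') (d + d')) = l (octic a b c d) + l (octic a' b' c' d')"
    for a b c d a' b' c' d'
    using add[OF o o, of a b c d a' b' c' d'] by (simp add: octic_def[abs_def] algebra_simps)
  have times: "l (octic (t * a) (t * b) (t * c) (t * d)) = t * l (octic a b c d)" for t a b c d
    using scale[OF o, of t a b c d] by (simp add: octic_def[abs_def] algebra_simps)
  show "l (octic a b c d) = a * l (octic 1 0 0 0) + b * l (octic 0 1 0 0)
      + c * l (octic 0 0 1 0) + d * l (octic 0 0 0 1)"
    \<comment> \<open>The instances of \<open>plus\<close> list a, a', b, b', c, c', d, d' in this
      order; each splits off one basis term.\<close>
    using plus[of a 0 0 b 0 0 0 0] plus[of a 0 b 0 0 c 0 0] plus[of a 0 b 0 c 0 0 d]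
      times[of a 1 0 0 0] times[of b 0 1 0 0] times[of c 0 0 1 0] times[of d 0 0 0 1] by simp
qed

lemma has_moments_add:
  assumes "has_moments l m0 m2 m3 m4" "has_moments l' n0 n2 n3 n4"
  shows "has_moments (\<lambda>f\<in>invariant_forms 8. l f + l' f) (m0 + n0) (m2 + n2) (m3 + n3) (m4 + n4)"
  using assms unfolding has_moments_def by (simp add: octic_in_invariant_forms algebra_simps)

text \<open>At a unit vector the first power sum is 1, so the basis octics reduce to 1,
  \<open>m2\<close>, \<open>m3\<close> and the square of \<open>m2\<close>.\<close>

lemma has_moments_point_eval:
  fixes a b c :: real
  defines "x \<equiv> a\<^sup>2" and "y \<equiv> b\<^sup>2" and "z \<equiv> c\<^sup>2"
  assumes "x + y + z = 1"
    and "m2 = x\<^sup>2 + y\<^sup>2 + z\<^sup>2 - x * y - y * z - z * x"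
    and "m3 = (2 * x - y - z) * (2 * y - x - z) * (2 * z - x - y) / 2"
  shows "has_moments (\<lambda>f\<in>invariant_forms 8. w * point_eval (invariant_forms 8) (vector [a, b, c]) f)
    w (w * m2) (w * m3) (w * m2\<^sup>2)"
proof -
  have "octic p q r s (vector [a, b, c] :: real ^ 3) = p + q * m2 + r * m3 + s * m2\<^sup>2" for p q r s
    unfolding octic_vector_3 x_def[symmetric] y_def[symmetric] z_def[symmetric] assms(4)
    by (simp add: assms(5,6))
  then show ?thesis
    unfolding has_moments_def point_eval_def
    by (simp add: octic_in_invariant_forms algebra_simps)
qed

section \<open>Moment vectors of the test evaluations\<close>

definition test_functionals :: "((real ^ 3 \<Rightarrow> real) \<Rightarrow> real) set" where
  "test_functionals = {point_eval (invariant_forms 8) (vector [a, sqrt (1 - a\<^sup>2), 0]) | a.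
         1 / 2 \<le> a \<and> a \<le> 1} \<union>
      {point_eval (invariant_forms 8) (vector [b, c, c]) | b c.
         0 \<le> b \<and> b \<le> 1 \<and> c = sqrt ((1 - b\<^sup>2) / 2)}"

definition cone_moments :: "real \<Rightarrow> real \<Rightarrow> real \<Rightarrow> real \<Rightarrow> bool" where
  "cone_moments m0 m2 m3 m4 \<longleftrightarrow>
     (\<exists>l\<in>cone_gen (invariant_forms 8) test_functionals. has_moments l m0 m2 m3 m4)"

lemma cone_moments_add:
  "cone_moments m0 m2 m3 m4 \<Longrightarrow> cone_moments n0 n2 n3 n4 \<Longrightarrow>
    cone_moments (m0 + n0) (m2 + n2) (m3 + n3) (m4 + n4)"
  unfolding cone_moments_def using cone_gen_add has_moments_add by blast

text \<open>The parameter s is the difference of the two distinct squared coordinates, (1 + 2 s) / 3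
  and (1 - s) / 3; the range of s corresponds to b between 0 and 1.\<close>

lemma cone_moments_two_equal:
  assumes "- 1 / 2 \<le> s" "s \<le> 1" "w \<ge> 0"
  shows "cone_moments w (w * s\<^sup>2) (w * s ^ 3) (w * s ^ 4)"
proof -
  define b where "b = sqrt ((1 + 2 * s) / 3)"
  define c where "c = sqrt ((1 - b\<^sup>2) / 2)"
  have b2: "b\<^sup>2 = (1 + 2 * s) / 3" using assms by (simp add: b_def)
  have c2: "c\<^sup>2 = (1 - s) / 3" using assms b2 by (simp add: c_def field_simps)
  have "0 \<le> b" "b \<le> 1" using assms by (simp_all add: b_def)
  then have "point_eval (invariant_forms 8) (vector [b, c, c]) \<in> test_functionals"
    unfolding test_functionals_def using c_def by blast
  moreover have "(s\<^sup>2)\<^sup>2 = s ^ 4" by simp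
  moreover have "has_moments (\<lambda>f\<in>invariant_forms 8. w * point_eval (invariant_forms 8) (vector [b, c, c]) f)
    w (w * s\<^sup>2) (w * s ^ 3) (w * (s\<^sup>2)\<^sup>2)"
    by (rule has_moments_point_eval) (simp_all only: b2 c2, simp_all add: field_simps power2_eq_square power3_eq_cube)
  ultimately show ?thesis
    unfolding cone_moments_def using cone_gen_generator assms(3) by metis
qed

lemma cone_moments_boundary:
  assumes "1 / 4 \<le> s" "s \<le> 1" "w \<ge> 0"
  shows "cone_moments w (w * s) (w * ((3 * s - 1) / 2)) (w * s\<^sup>2)"
proof -
  \<comment> \<open>If x + y = 1 and the third squared coordinate is 0, the second moment is 1 - 3 x
    y. Hence x y = (1 - s) / 3, and \<open>r\<close> is the root of the discriminant of the
    quadratic with roots x and y; it is real because s is at least 1/4. The larger root becomes the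
    square of \<open>a\<close>, which keeps \<open>a\<close> above 1/2.\<close>
  define r where "r = sqrt (1 - 4 * ((1 - s) / 3))"
  define a where "a = sqrt ((1 + r) / 2)"
  have r: "r\<^sup>2 = 1 - 4 * ((1 - s) / 3)" "0 \<le> r" "r \<le> 1" using assms by (simp_all add: r_def)
  have s: "s = (1 + 3 * r\<^sup>2) / 4" using r(1) by (simp add: field_simps)
  have a2: "a\<^sup>2 = (1 + r) / 2" using r by (simp add: a_def)
  have "1 / 2 \<le> a"
    unfolding a_def using r by (intro real_le_rsqrt) (simp add: power2_eq_square)
  moreover have "a \<le> 1" using r by (simp add: a_def)
  ultimately have "1 / 2 \<le> a \<and> a \<le> 1" by blast
  then have "point_eval (invariant_forms 8) (vector [a, sqrt (1 - a\<^sup>2), 0]) \<in> test_functionals"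
    unfolding test_functionals_def by blast
  moreover have y2: "(sqrt (1 - a\<^sup>2))\<^sup>2 = (1 - r) / 2" using r a2 by (simp add: field_simps)
  have "has_moments (\<lambda>f\<in>invariant_forms 8. w * point_eval (invariant_forms 8) (vector [a, sqrt (1 - a\<^sup>2), 0]) f)
    w (w * s) (w * ((3 * s - 1) / 2)) (w * s\<^sup>2)"
    by (intro has_moments_point_eval; unfold y2; unfold a2)
      (simp_all add: s field_simps power2_eq_square)
  ultimately show ?thesis
    unfolding cone_moments_def using cone_gen_generator assms(3) by blast
qed

section \<open>Decomposition into test evaluations\<close>

text \<open>Normalised to \<open>m0 = 1\<close>; with every weight allowed, convex combinations need
  no division.\<close>

definition unit_moments :: "real \<Rightarrow> real \<Rightarrow> real \<Rightarrow> bool" where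
  "unit_moments m2 m3 m4 \<longleftrightarrow> (\<forall>w\<ge>0. cone_moments w (w * m2) (w * m3) (w * m4))"

lemma unit_moments_convex:
  assumes "unit_moments a2 a3 a4" "unit_moments b2 b3 b4" "0 \<le> t" "t \<le> 1"
    and "m2 = (1 - t) * a2 + t * b2" "m3 = (1 - t) * a3 + t * b3" "m4 = (1 - t) * a4 + t * b4"
  shows "unit_moments m2 m3 m4"
  unfolding unit_moments_def
proof (intro allI impI)
  fix w :: real
  assume "w \<ge> 0"
  then have "cone_moments (w * (1 - t)) (w * (1 - t) * a2) (w * (1 - t) * a3) (w * (1 - t) * a4)"
    "cone_moments (w * t) (w * t * b2) (w * t * b3) (w * t * b4)"
    using assms(1-4) unfolding unit_moments_def by auto
  from cone_moments_add[OF this] show "cone_moments w (w * m2) (w * m3) (w * m4)"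
    unfolding assms(5-7) by (simp add: algebra_simps)
qed

lemma unit_moments_two_equal:
  "- 1 / 2 \<le> s \<Longrightarrow> s \<le> 1 \<Longrightarrow> unit_moments (s\<^sup>2) (s ^ 3) (s ^ 4)"
  unfolding unit_moments_def using cone_moments_two_equal by blast

lemma unit_moments_boundary:
  "1 / 4 \<le> s \<Longrightarrow> s \<le> 1 \<Longrightarrow> unit_moments s ((3 * s - 1) / 2) (s\<^sup>2)"
  unfolding unit_moments_def using cone_moments_boundary by blast

lemma between_convex_combination:
  fixes a b c :: real
  assumes "a \<le> c" "c \<le> b"
  obtains t where "0 \<le> t" "t \<le> 1" "c = (1 - t) * a + t * b"
proof (cases "a = b")
  case True
  then show ?thesis using assms that[of 0] by simp
next
  case False
  then have ab: "a < b" using assms by simp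
  define t where "t = (c - a) / (b - a)"
  have "t * (b - a) = c - a" using ab by (simp add: t_def)
  then have "c = (1 - t) * a + t * b" by (simp add: algebra_simps)
  moreover have "0 \<le> t" "t \<le> 1" using ab assms by (simp_all add: t_def)
  ultimately show ?thesis using that by blast
qed

text \<open>Here \<open>m3\<close> is an affine function of \<open>m2\<close>, so only the point
  (\<open>m2\<close>, \<open>m4\<close>) matters. It lies between the parabola of the boundary
  evaluations and the chord joining their end points s = 1/4 and s = 1.\<close>

lemma unit_moments_face_e3:
  assumes "m2\<^sup>2 \<le> m4" "1 - 3 * m2 + 2 * m3 = 0" "0 \<le> m2 + m3 - 2 * m4"
  shows "unit_moments m2 m3 m4"
proof -
  have m3: "m3 = (3 * m2 - 1) / 2" using assms(2) by simp
  have m4: "m4 \<le> (5 * m2 - 1) / 4" using assms(3) unfolding m3 by (simp add: field_simps)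
  then have "0 \<le> (4 * m2 - 1) * (1 - m2)"
    using assms(1) by (simp add: power2_eq_square algebra_simps)
  then have m2: "1 / 4 \<le> m2" "m2 \<le> 1"
    by (auto simp: zero_le_mult_iff)
  obtain t where t: "0 \<le> t" "t \<le> 1" "m4 = (1 - t) * m2\<^sup>2 + t * ((5 * m2 - 1) / 4)"
    using between_convex_combination[OF assms(1) m4] .
  have "unit_moments (1 / 4) (- 1 / 8) (1 / 16)" "unit_moments 1 1 1"
    using unit_moments_boundary[of "1 / 4"] unit_moments_boundary[of 1]
    by (simp_all add: power2_eq_square)
  then have "unit_moments m2 m3 ((5 * m2 - 1) / 4)"
    \<comment> \<open>The value of t is the relative position of \<open>m2\<close> between 1/4 and
      1.\<close>
    by (rule unit_moments_convex[where t = "(4 * m2 - 1) / 3"]) (use m2 in \<open>simp_all add: m3 field_simps\<close>)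
  with unit_moments_boundary[OF m2] show ?thesis
    using t(1,2) by (rule unit_moments_convex) (simp_all add: t(3) m3 field_simps)
qed

text \<open>With \<open>m2\<close> and \<open>m4\<close> fixed, only \<open>m3\<close> varies. The
  upper end of its range is the two-equal evaluation at s = sqrt \<open>m2\<close>; the lower end is
  the one at -s if s is at most 1/2, and otherwise the boundary evaluation with the same
  \<open>m2\<close>.\<close>

lemma unit_moments_degenerate:
  assumes "m3\<^sup>2 \<le> m2 ^ 3" "0 \<le> 1 - 3 * m2 + 2 * m3" "0 \<le> m2 + m3 - 2 * m2\<^sup>2"
  shows "unit_moments m2 m3 (m2\<^sup>2)"
proof -
  define s where "s = sqrt m2"
  have "0 \<le> m2 ^ 3" using assms(1) order_trans[OF zero_le_power2] by blast
  then have "0 \<le> m2" by (simp add: zero_le_power_eq)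
  then have s: "0 \<le> s" "m2 = s\<^sup>2" by (simp_all add: s_def)
  have "m3\<^sup>2 \<le> (s ^ 3)\<^sup>2" using assms(1) s by (simp flip: power_mult)
  then have "\<bar>m3\<bar> \<le> s ^ 3" using s(1) abs_le_square_iff[of m3 "s ^ 3"] by simp
  then have m3: "m3 \<le> s ^ 3" "- (s ^ 3) \<le> m3" by simp_all
  have s4: "m2\<^sup>2 = s ^ 4" using s by simp
  \<comment> \<open>The last hypothesis and the upper bound on \<open>m3\<close> give 0 \<le> s^2 (1
    - s) (1 + 2 s).\<close>
  have s1: "s \<le> 1"
  proof (rule ccontr)
    assume "\<not> s \<le> 1"
    then have "0 < s\<^sup>2 * ((s - 1) * (2 * s + 1))" by simp
    moreover have "s\<^sup>2 + s ^ 3 - 2 * s ^ 4 = - (s\<^sup>2 * ((s - 1) * (2 * s + 1)))"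
      by algebra
    ultimately show False using assms(3) m3(1) s(2) s4 by simp
  qed
  have top: "unit_moments m2 (s ^ 3) (m2\<^sup>2)"
    using unit_moments_two_equal[of s] s s1 s4 by simp
  have "\<exists>a\<le>m3. unit_moments m2 a (m2\<^sup>2)"
  proof (cases "s \<le> 1 / 2")
    case True
    then show ?thesis
      using unit_moments_two_equal[of "- s"] s s4 m3(2) by (intro exI[of _ "- (s ^ 3)"]) simp
  next
    case False
    then have "(1 / 2)\<^sup>2 \<le> s\<^sup>2" by (intro power_mono) auto
    moreover have "s\<^sup>2 \<le> 1" using s s1 by (simp add: power_le_one)
    ultimately show ?thesis
      using unit_moments_boundary[of m2] s assms(2)
      by (intro exI[of _ "(3 * m2 - 1) / 2"]) (simp add: power2_eq_square)
  qed
  then obtain a where a: "a \<le> m3" "unit_moments m2 a (m2\<^sup>2)" by blast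
  obtain t where "0 \<le> t" "t \<le> 1" "m3 = (1 - t) * a + t * s ^ 3"
    using between_convex_combination[OF a(1) m3(1)] .
  then show ?thesis
    by (intro unit_moments_convex[OF a(2) top]) (simp_all add: algebra_simps)
qed

text \<open>
  Moving away from the point \<open>s = 0\<close>, whose moments vanish, until either
  \<open>m2\<^sup>2 \<le> m0 * m4\<close> or \<open>0 \<le> m0 - 3 * m2 + 2 * m3\<close> becomes an equality
  reduces the claim to the two preceding lemmas.
\<close>

lemma unit_moments_main:
  assumes A: "m2\<^sup>2 \<le> m4" and D: "m3\<^sup>2 \<le> m2 * m4"
    and B: "0 \<le> 1 - 3 * m2 + 2 * m3" and C: "0 \<le> m2 + m3 - 2 * m4"
  shows "unit_moments m2 m3 m4"
proof (cases "m4 = 0")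
  case True
  then show ?thesis using A D unit_moments_two_equal[of 0] by simp
next
  case False
  then have m4: "m4 > 0" using A order_trans[OF zero_le_power2 A] by simp
  have "0 \<le> m2" using D m4 order_trans[OF zero_le_power2 D] by (simp add: zero_le_mult_iff)
  moreover have "m2 \<noteq> 0" using C D m4 by auto
  ultimately have m2: "m2 > 0" by simp
  \<comment> \<open>The least \<open>m0\<close> for which both inequalities still hold; the larger
    entry of the maximum is the one that becomes tight.\<close>
  define t where "t = max (m2\<^sup>2 / m4) (3 * m2 - 2 * m3)"
  have t: "0 < t" "t \<le> 1"
    using m2 m4 A B by (auto simp: t_def less_max_iff_disj)
  have At: "m2\<^sup>2 \<le> t * m4"
    using m4 by (simp add: t_def pos_divide_le_eq[symmetric])
  have Bt: "0 \<le> t - 3 * m2 + 2 * m3" by (simp add: t_def)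
  have scaled: "unit_moments (m2 / t) (m3 / t) (m4 / t)"
  proof (cases "t = 3 * m2 - 2 * m3")
    case True
    show ?thesis
    proof (rule unit_moments_face_e3)
      show "(m2 / t)\<^sup>2 \<le> m4 / t" using At t by (simp add: field_simps power2_eq_square)
      have "1 - 3 * (m2 / t) + 2 * (m3 / t) = (t - 3 * m2 + 2 * m3) / t"
        using t by (simp add: field_simps)
      then show "1 - 3 * (m2 / t) + 2 * (m3 / t) = 0" using True by simp
      have "m2 / t + m3 / t - 2 * (m4 / t) = (m2 + m3 - 2 * m4) / t"
        using t by (simp add: field_simps)
      then show "0 \<le> m2 / t + m3 / t - 2 * (m4 / t)" using C t by simp
    qed
  next
    case False
    then have "t = m2\<^sup>2 / m4" unfolding t_def by linarith
    then have "m4 * t = m2\<^sup>2" using m4 by simp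
    then have mt: "m4 = m2\<^sup>2 / t" using t(1) by (simp add: field_simps)
    have m4t: "m4 / t = (m2 / t)\<^sup>2" unfolding mt by (simp add: power2_eq_square)
    show ?thesis unfolding m4t
    proof (rule unit_moments_degenerate)
      have "m3\<^sup>2 / t\<^sup>2 \<le> m2 * m4 / t\<^sup>2" using D by (intro divide_right_mono) auto
      then show "(m3 / t)\<^sup>2 \<le> (m2 / t) ^ 3"
        unfolding mt by (simp add: power2_eq_square power3_eq_cube)
      have "1 - 3 * (m2 / t) + 2 * (m3 / t) = (t - 3 * m2 + 2 * m3) / t"
        using t by (simp add: field_simps)
      then show "0 \<le> 1 - 3 * (m2 / t) + 2 * (m3 / t)" using Bt t by simp
      have "m2 / t + m3 / t - 2 * (m4 / t) = (m2 + m3 - 2 * m4) / t"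
        using t by (simp add: field_simps)
      then show "0 \<le> m2 / t + m3 / t - 2 * (m2 / t)\<^sup>2" using C t m4t by simp
    qed
  qed
  \<comment> \<open>This is the evaluation where all squared coordinates are 1/3; it receives the
    remaining weight 1 - t.\<close>
  have "unit_moments 0 0 0" using unit_moments_two_equal[of 0] by simp
  from unit_moments_convex[OF this scaled, of t] t show ?thesis by simp
qed

text \<open>Division by \<open>m0\<close> gives the normalised case. If \<open>m0 = 0\<close>, the
  inequalities force all the other moments to vanish.\<close>

lemma cone_moments_main:
  assumes "0 \<le> m0" "m2\<^sup>2 \<le> m0 * m4" "m3\<^sup>2 \<le> m2 * m4"
    and "0 \<le> m0 - 3 * m2 + 2 * m3" "0 \<le> m2 + m3 - 2 * m4" "0 \<le> m4"
  shows "cone_moments m0 m2 m3 m4"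
proof (cases "m0 = 0")
  case True
  then have "m2 = 0" "m3 = 0" "m4 = 0" using assms by auto
  then show ?thesis using True cone_moments_two_equal[of 0 0] by simp
next
  case False
  then have m0: "m0 > 0" using assms(1) by simp
  have "unit_moments (m2 / m0) (m3 / m0) (m4 / m0)"
  proof (rule unit_moments_main)
    show "(m2 / m0)\<^sup>2 \<le> m4 / m0" using assms(2) m0 by (simp add: field_simps power2_eq_square)
    have "m3\<^sup>2 / m0\<^sup>2 \<le> m2 * m4 / m0\<^sup>2" using assms(3) by (intro divide_right_mono) auto
    then show "(m3 / m0)\<^sup>2 \<le> m2 / m0 * (m4 / m0)" by (simp add: power2_eq_square)
    have "1 - 3 * (m2 / m0) + 2 * (m3 / m0) = (m0 - 3 * m2 + 2 * m3) / m0"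
      using m0 by (simp add: field_simps)
    then show "0 \<le> 1 - 3 * (m2 / m0) + 2 * (m3 / m0)" using assms(4) m0 by simp
    have "m2 / m0 + m3 / m0 - 2 * (m4 / m0) = (m2 + m3 - 2 * m4) / m0"
      using m0 by (simp add: field_simps)
    then show "0 \<le> m2 / m0 + m3 / m0 - 2 * (m4 / m0)" using assms(5) m0 by simp
  qed
  then have "cone_moments m0 (m0 * (m2 / m0)) (m0 * (m3 / m0)) (m0 * (m4 / m0))"
    using assms(1) unfolding unit_moments_def by (elim allE impE)
  then show ?thesis using m0 by simp
qed

section \<open>Inequalities from sums of squares\<close>

lemma discriminant_nonneg:
  fixes p q r :: real
  assumes "\<And>a b. 0 \<le> a\<^sup>2 * p + 2 * a * b * q + b\<^sup>2 * r"
  shows "q\<^sup>2 \<le> p * r" "0 \<le> p" "0 \<le> r"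
proof -
  show p: "0 \<le> p" and r: "0 \<le> r" using assms[of 1 0] assms[of 0 1] by simp_all
  show "q\<^sup>2 \<le> p * r"
  proof (cases "r = 0")
    case True
    \<comment> \<open>With r = 0 the form is linear in b; b = p + 1 is large enough for a = -q to
      make it negative unless q = 0.\<close>
    have "0 \<le> - (q\<^sup>2 * (p + 2))"
      using assms[of "- q" "p + 1"] True by (simp add: power2_eq_square algebra_simps)
    then have "q\<^sup>2 \<le> 0" using p by (simp add: mult_le_0_iff)
    then show ?thesis using True by simp
  next
    case False
    then have "0 \<le> r * (p * r - q\<^sup>2)"
      using assms[of r "- q"] by (simp add: power2_eq_square algebra_simps)
    then show ?thesis using r False by (simp add: zero_le_mult_iff)
  qed
qed

text \<open>A common shape for all certificates below: shorter sums are padded with zero, and the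
  factor k enters the summands as sqrt k.\<close>

lemma dual_cone_three_squares:
  fixes l :: "(real ^ 3 \<Rightarrow> real) \<Rightarrow> real"
  assumes l: "l \<in> dual_cone (invariant_forms 8) (invariant_sos 4)"
    and g: "f \<in> forms 4" "g \<in> forms 4" "h \<in> forms 4" and "0 \<le> k"
    and eq: "\<And>x :: real ^ 3. octic p q r s x = k * ((f x)\<^sup>2 + (g x)\<^sup>2 + (h x)\<^sup>2)"
  shows "0 \<le> l (octic p q r s)"
proof -
  define G where "G i = (\<lambda>x. sqrt k * ([f, g, h] ! i) x)" for i
  have "\<forall>i<3. G i \<in> forms 4"
    unfolding G_def using g by (auto intro!: forms_scale simp: less_Suc_eq numeral_3_eq_3)
  moreover have "octic p q r s = (\<lambda>x. \<Sum>i<3. (G i x)\<^sup>2)"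
    using \<open>0 \<le> k\<close> by (auto simp: eq G_def fun_eq_iff numeral_3_eq_3 power_mult_distrib algebra_simps)
  ultimately have "\<exists>(k::nat) (g :: nat \<Rightarrow> real ^ 3 \<Rightarrow> real). (\<forall>i<k. g i \<in> forms 4) \<and> octic p q r s = (\<lambda>x. \<Sum>i<k. (g i x)\<^sup>2)"
    by (intro exI[where x = "3 :: nat"] exI[where x = G] conjI)
  then have "(octic p q r s :: real ^ 3 \<Rightarrow> real) \<in> invariant_sos 4"
    unfolding invariant_sos_def by (simp add: octic_in_invariant_forms)
  then show ?thesis using l by (auto simp: dual_cone_def)
qed

lemma forms_4_mult_2: "f \<in> forms 2 \<Longrightarrow> g \<in> forms 2 \<Longrightarrow> (\<lambda>x. f x * g x) \<in> forms 4"
  using forms_mult[of f 2 g 2] by simp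

lemma forms_2_coords: "(\<lambda>x :: real ^ 'n. x $ i * x $ j) \<in> forms 2"
  using forms_mult[OF forms_coord forms_coord, of i j] by (simp add: numeral_2_eq_2)

lemma forms_2_square: "(\<lambda>x :: real ^ 'n. (x $ i)\<^sup>2) \<in> forms 2"
  using forms_2_coords[of i i] by (simp add: power2_eq_square)

text \<open>Doubling removes the fraction in the cubic term, so the certificates become identities
  with integer coefficients.\<close>

lemma octic_coords:
  fixes u :: "real ^ 3"
  defines "x \<equiv> (u $ 1)\<^sup>2" and "y \<equiv> (u $ 2)\<^sup>2" and "z \<equiv> (u $ 3)\<^sup>2"
  shows "2 * octic p q r s u =
    2 * p * (x + y + z)^4 + 2 * q * ((x + y + z)\<^sup>2 * (x\<^sup>2 + y\<^sup>2 + z\<^sup>2 - x * y - y * z - z * x))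
    + r * ((x + y + z) * ((2 * x - y - z) * (2 * y - x - z) * (2 * z - x - y)))
    + 2 * s * (x\<^sup>2 + y\<^sup>2 + z\<^sup>2 - x * y - y * z - z * x)\<^sup>2"
  using octic_vector_3[of p q r s "u $ 1" "u $ 2" "u $ 3", folded vector_3_eta]
  unfolding x_def y_def z_def by simp

text \<open>Each inequality is the nonnegativity of \<open>l\<close> on explicit sums of squares.
  The two quadratic ones come from families with parameters a and b, through
  \<open>discriminant_nonneg\<close>.\<close>

lemma dual_cone_moment_inequalities:
  assumes l: "l \<in> dual_cone (invariant_forms 8 :: (real ^ 3 \<Rightarrow> real) set) (invariant_sos 4)"
    and m: "has_moments l m0 m2 m3 m4"
  shows "0 \<le> m0" "m2\<^sup>2 \<le> m0 * m4" "m3\<^sup>2 \<le> m2 * m4"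
    and "0 \<le> m0 - 3 * m2 + 2 * m3" "0 \<le> m2 + m3 - 2 * m4" "0 \<le> m4"
proof -
  have lo: "l (octic a b c d) = a * m0 + b * m2 + c * m3 + d * m4" for a b c d
    using m by (simp add: has_moments_def)
  have "0 \<le> a\<^sup>2 * m0 + 2 * a * b * m2 + b\<^sup>2 * m4" for a b
  proof -
    have "0 \<le> l (octic (a\<^sup>2) (2 * a * b) 0 (b\<^sup>2))"
    proof (rule dual_cone_three_squares[OF l, of "\<lambda>x. a * (even_power_sum 1 x)\<^sup>2 + b * quad_sym x" "\<lambda>_. 0" "\<lambda>_. 0" 1])
      show "(\<lambda>x. a * (even_power_sum 1 x)\<^sup>2 + b * quad_sym x) \<in> forms 4"
        using forms_power[OF even_power_sum_in_forms[of 2 1], of 2] quad_sym_in_forms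
        by (intro forms_add forms_scale) simp_all
      show "octic (a\<^sup>2) (2 * a * b) 0 (b\<^sup>2) x =
        1 * ((a * (even_power_sum 1 x)\<^sup>2 + b * quad_sym x)\<^sup>2 + 0\<^sup>2 + 0\<^sup>2)" for x
        unfolding octic_def by (simp add: power2_eq_square power4_eq_xxxx algebra_simps)
    qed (simp_all add: forms_zero)
    then show ?thesis by (simp add: lo)
  qed
  from discriminant_nonneg[OF this] show "m2\<^sup>2 \<le> m0 * m4" "0 \<le> m0" "0 \<le> m4" .
  have "0 \<le> a\<^sup>2 * m2 + 2 * a * b * m3 + b\<^sup>2 * m4" for a b
  proof -
    \<comment> \<open>For distinct i, j, k and squared coordinates X this is (X_i - X_j) (a p + b
      (X_i + X_j - 2 X_k)), with p the sum of the X. The a^2 part of the sum of squares is p^2 times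
      the sum of squared differences, that is 2 p^2 q with q = \<open>quad_sym\<close>.\<close>
    define g where "g i j k x = ((x $ i)\<^sup>2 - (x $ j)\<^sup>2) *
      ((a + b) * ((x $ 1)\<^sup>2 + (x $ 2)\<^sup>2 + (x $ 3)\<^sup>2) - 3 * b * (x $ k)\<^sup>2)" for i j k and x :: "real ^ 3"
    have g: "g i j k \<in> forms 4" for i j k
      unfolding g_def[abs_def]
      by (intro forms_4_mult_2 forms_diff forms_scale forms_add forms_2_square)
    have "0 \<le> l (octic 0 (2 * a\<^sup>2) (4 * a * b) (2 * b\<^sup>2))"
    proof (rule dual_cone_three_squares[OF l g[of 1 2 3] g[of 2 3 1] g[of 3 1 2], of 1])
      fix x :: "real ^ 3"
      have "2 * octic 0 (2 * a\<^sup>2) (4 * a * b) (2 * b\<^sup>2) x =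
          2 * ((g 1 2 3 x)\<^sup>2 + (g 2 3 1 x)\<^sup>2 + (g 3 1 2 x)\<^sup>2)"
        unfolding octic_coords g_def by algebra
      then show "octic 0 (2 * a\<^sup>2) (4 * a * b) (2 * b\<^sup>2) x =
          1 * ((g 1 2 3 x)\<^sup>2 + (g 2 3 1 x)\<^sup>2 + (g 3 1 2 x)\<^sup>2)"
        by simp
    qed simp
    then show ?thesis by (simp add: lo)
  qed
  from discriminant_nonneg(1)[OF this] show "m3\<^sup>2 \<le> m2 * m4" .
  \<comment> \<open>In squared coordinates the three squares add up to x y z (x + y + z), which
    vanishes wherever a coordinate is zero.\<close>
  define e where "e i x = (x $ 1 * x $ 2) * (x $ 3 * x $ i)" for i and x :: "real ^ 3"
  have e: "e i \<in> forms 4" for i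
    unfolding e_def[abs_def] by (intro forms_4_mult_2 forms_2_coords)
  have "0 \<le> l (octic 1 (-3) 2 0)"
  proof (rule dual_cone_three_squares[OF l e[of 1] e[of 2] e[of 3], of 27])
    fix x :: "real ^ 3"
    have "2 * octic 1 (-3) 2 0 x = 2 * (27 * ((e 1 x)\<^sup>2 + (e 2 x)\<^sup>2 + (e 3 x)\<^sup>2))"
      unfolding octic_coords e_def by algebra
    then show "octic 1 (-3) 2 0 x = 27 * ((e 1 x)\<^sup>2 + (e 2 x)\<^sup>2 + (e 3 x)\<^sup>2)"
      by simp
  qed simp
  then show "0 \<le> m0 - 3 * m2 + 2 * m3" by (simp add: lo)
  \<comment> \<open>In squared coordinates the squares are x y (x - y)^2 and its cyclic images.
    Their sum vanishes at (1, 0, 0), (1, 1, 0) and (1, 1, 1), which include both end points of the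
    chord in \<open>unit_moments_face_e3\<close> up to scaling.\<close>
  define h where "h i j x = (x $ i * x $ j) * ((x $ i)\<^sup>2 - (x $ j)\<^sup>2)" for i j and x :: "real ^ 3"
  have h: "h i j \<in> forms 4" for i j
    unfolding h_def[abs_def] by (intro forms_4_mult_2 forms_diff forms_2_coords forms_2_square)
  have "0 \<le> l (octic 0 2 2 (-4))"
  proof (rule dual_cone_three_squares[OF l h[of 1 2] h[of 2 3] h[of 3 1], of 9])
    fix x :: "real ^ 3"
    have "2 * octic 0 2 2 (-4) x = 2 * (9 * ((h 1 2 x)\<^sup>2 + (h 2 3 x)\<^sup>2 + (h 3 1 x)\<^sup>2))"
      unfolding octic_coords h_def by algebra
    then show "octic 0 2 2 (-4) x = 9 * ((h 1 2 x)\<^sup>2 + (h 2 3 x)\<^sup>2 + (h 3 1 x)\<^sup>2)"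
      by simp
  qed simp
  then show "0 \<le> m2 + m3 - 2 * m4" by (simp add: lo)
qed

section \<open>Comparison of the two cones\<close>

text \<open>The easy inclusion, for any set of evaluation points: a sum of squares is nonnegative at
  each of them.\<close>

lemma cone_gen_point_evals_subset_dual_cone:
  fixes S :: "((real ^ 'n \<Rightarrow> real) \<Rightarrow> real) set"
  assumes "S \<subseteq> range (point_eval (invariant_forms (2 * d)))"
  shows "cone_gen (invariant_forms (2 * d)) S \<subseteq> dual_cone (invariant_forms (2 * d)) (invariant_sos d)"
proof
  let ?V = "invariant_forms (2 * d) :: (real ^ 'n \<Rightarrow> real) set"
  fix l
  assume "l \<in> cone_gen ?V S"
  then obtain F w where l: "l = (\<lambda>f\<in>?V. \<Sum>h\<in>F. w h * h f)"
    and F: "F \<subseteq> S" "\<forall>h\<in>F. w h \<ge> 0"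
    unfolding cone_gen_def by blast
  have ev: "\<exists>z. \<forall>f\<in>?V. h f = f z" if "h \<in> F" for h
    using that F(1) assms by (force simp: point_eval_def)
  have add: "h (\<lambda>x. f x + g x) = h f + h g" if "h \<in> F" "f \<in> ?V" "g \<in> ?V" for h f g
    using ev[OF that(1)] that(2,3) invariant_forms_add[OF that(2,3)] by fastforce
  have scale: "h (\<lambda>x. r * f x) = r * h f" if "h \<in> F" "f \<in> ?V" for h f r
    using ev[OF that(1)] that(2) invariant_forms_scale[OF that(2)] by fastforce
  have "l \<in> functionals ?V"
    unfolding functionals_def
  proof (intro CollectI conjI ballI allI)
    show "l \<in> extensional ?V" by (simp add: l)
    show "l (\<lambda>x. f x + g x) = l f + l g" if "f \<in> ?V" "g \<in> ?V" for f g
      using that by (simp add: l invariant_forms_add add distrib_left sum.distrib)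
    show "l (\<lambda>x. r * f x) = r * l f" if "f \<in> ?V" for f r
    proof -
      have "(\<Sum>h\<in>F. w h * h (\<lambda>x. r * f x)) = (\<Sum>h\<in>F. r * (w h * h f))"
        using that by (intro sum.cong refl) (simp add: scale)
      then show ?thesis
        using that by (simp add: l invariant_forms_scale sum_distrib_left)
    qed
  qed
  moreover have "0 \<le> l f" if "f \<in> invariant_sos d" for f
  proof -
    have f: "f \<in> ?V" "\<And>x. 0 \<le> f x"
      using that by (auto simp: invariant_sos_def intro!: sum_nonneg)
    have "0 \<le> h f" if "h \<in> F" for h
      using ev[OF that] f by auto
    then show ?thesis
      using f(1) F(2) by (auto simp: l intro!: sum_nonneg)
  qed
  ultimately show "l \<in> dual_cone ?V (invariant_sos d)"
    by (simp add: dual_cone_def)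
qed

theorem theorem4p1:
  "dual_cone (invariant_forms 8 :: (real ^ 3 \<Rightarrow> real) set) (invariant_sos 4) =
   cone_gen (invariant_forms 8)
     ({point_eval (invariant_forms 8) (vector [a, sqrt (1 - a\<^sup>2), 0]) | a.
         1 / 2 \<le> a \<and> a \<le> 1} \<union>
      {point_eval (invariant_forms 8) (vector [b, c, c]) | b c.
         0 \<le> b \<and> b \<le> 1 \<and> c = sqrt ((1 - b\<^sup>2) / 2)})"
  unfolding test_functionals_def[symmetric]
proof
  have "test_functionals \<subseteq> range (point_eval (invariant_forms (2 * 4)))"
    unfolding test_functionals_def by auto
  from cone_gen_point_evals_subset_dual_cone[OF this]
  show "cone_gen (invariant_forms 8) test_functionals
      \<subseteq> dual_cone (invariant_forms 8 :: (real ^ 3 \<Rightarrow> real) set) (invariant_sos 4)"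
    by simp
next
  show "dual_cone (invariant_forms 8 :: (real ^ 3 \<Rightarrow> real) set) (invariant_sos 4)
      \<subseteq> cone_gen (invariant_forms 8) test_functionals"
  proof
    fix l :: "(real ^ 3 \<Rightarrow> real) \<Rightarrow> real"
    assume l: "l \<in> dual_cone (invariant_forms 8) (invariant_sos 4)"
    then have "l \<in> functionals (invariant_forms 8)" by (simp add: dual_cone_def)
    note m = functional_has_moments[OF this]
    \<comment> \<open>Some member of the generated cone has the same moments as \<open>l\<close>,
      and equal moments make the two functionals equal.\<close>
    have "cone_moments (l (octic 1 0 0 0)) (l (octic 0 1 0 0)) (l (octic 0 0 1 0)) (l (octic 0 0 0 1))"
      by (rule cone_moments_main) (rule dual_cone_moment_inequalities[OF l m])+
    then obtain l' where l': "l' \<in> cone_gen (invariant_forms 8) test_functionals"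
      "has_moments l' (l (octic 1 0 0 0)) (l (octic 0 1 0 0)) (l (octic 0 0 1 0)) (l (octic 0 0 0 1))"
      unfolding cone_moments_def by blast
    show "l \<in> cone_gen (invariant_forms 8) test_functionals"
      unfolding has_moments_unique[OF m l'(2)] by (rule l'(1))
  qed
qed

end
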